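(* Let $\omega=(\omega_n)_{n\ge1}$ be an i.i.d. sequence of random points uniformly distributed on $\mathbb{T}=\mathbb{R}/\mathbb{Z}$, and for a sequence $(r_n)_{n\ge1}$ of positive real numbers let $\mathcal{U}(\omega)=\{y\in\mathbb{T}:\ \exists N_0\ \forall N\ge N_0\ \exists\, 1\le n\le N,\ \|\omega_n-y\|<r_N\}$. If $r_n=\frac cn$ for all $n\ge 1$, where $0<c<\frac12$, then almost surely $$\dim_{\mathrm H}\mathcal{U}(\omega)\le\inf_{\theta>1}\frac{\log\Lambda}{\log\theta},$$ where $$\Lambda=\frac{1+\Theta+\Delta}{2}+\sqrt{\Bigl(\frac{1+\Theta+\Delta}{2}\Bigr)^2-\Delta},\qquad \Theta=2c(\theta-1)(1+\theta^{-2}),\qquad \Delta=2c(\theta-1)(\theta^{-1}-\theta^{-2}).$$ In particular, $\inf_{\theta>1}\frac{\log\Lambda}{\log\theta}$ tends to $0$ as $c\to0$, and $\dim_{\mathrm H}\mathcal{U}(\omega)=0$ almost surely when $r_n=1/n^\alpha$ for all $n\ge 1$ with $\alpha>1$.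
   Context: $\mathbb{T}=\mathbb{R}/\mathbb{Z}$ is the one-dimensional torus with normalized Lebesgue (uniform) measure, $\|x\|$ denotes the distance of $x\in\mathbb{T}$ to $0$ (the distance of a real representative of $x$ to the nearest integer), and $\dim_{\mathrm H}$ is the Hausdorff dimension with respect to the metric $\|x-y\|$. The infimum is over real $\theta>1$; $\Theta,\Delta,\Lambda$ depend on $c$ and $\theta$. *)

theory Defs
  imports "HOL-Probability.Probability"
begin

section \<open>The torus\<close>

definition dist_to_int :: "real \<Rightarrow> real" where
  "dist_to_int x = \<bar>x - of_int (round x)\<bar>"

lemma dist_to_int_le: "dist_to_int x \<le> \<bar>x - of_int m\<bar>"
  unfolding dist_to_int_def by (rule round_diff_minimal)

lemma dist_to_int_add_int: "dist_to_int (x + of_int m) = dist_to_int x"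
proof -
  have eq: "x + of_int m + 1 / 2 = (x + 1 / 2) + of_int m" by linarith
  have "round (x + of_int m) = round x + m"
    unfolding round_def eq by (rule floor_add_int [symmetric])
  thus ?thesis by (simp add: dist_to_int_def)
qed

lemma dist_to_int_minus: "dist_to_int (- x) = dist_to_int x"
proof -
  have *: "dist_to_int (- y) \<le> dist_to_int y" for y
    using dist_to_int_le[of "- y" "- round y"] unfolding dist_to_int_def by simp
  show ?thesis
  proof (rule antisym)
    show "dist_to_int (- x) \<le> dist_to_int x" by (rule *)
    show "dist_to_int x \<le> dist_to_int (- x)" using *[of "- x"] by simp
  qed
qed

lemma dist_to_int_triangle: "dist_to_int (x + y) \<le> dist_to_int x + dist_to_int y"
  using dist_to_int_le[of "x + y" "round x + round y"] unfolding dist_to_int_def by linarith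

lemma dist_to_int_eq_0_iff: "dist_to_int x = 0 \<longleftrightarrow> x \<in> \<int>"
proof
  assume "dist_to_int x = 0"
  hence "\<exists>k. x = of_int k" by (intro exI[of _ "round x"]) (simp add: dist_to_int_def)
  thus "x \<in> \<int>" by auto
next
  assume "x \<in> \<int>"
  thus "dist_to_int x = 0" by (auto simp: dist_to_int_def elim: Ints_cases)
qed

quotient_type torus = real / "\<lambda>x y :: real. x - y \<in> \<int>"
  morphisms torus_rep torus_of_real
proof (rule equivpI)
  show "reflp (\<lambda>x y :: real. x - y \<in> \<int>)" by (simp add: reflp_def)
  show "symp (\<lambda>x y :: real. x - y \<in> \<int>)"
  proof (rule sympI)
    fix x y :: real assume "x - y \<in> \<int>"
    from Ints_minus[OF this] show "y - x \<in> \<int>" by (simp only: minus_diff_eq)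
  qed
  show "transp (\<lambda>x y :: real. x - y \<in> \<int>)"
  proof (rule transpI)
    fix x y z :: real assume "x - y \<in> \<int>" "y - z \<in> \<int>"
    from Ints_add[OF this] show "x - z \<in> \<int>" by (simp only: diff_add_cancel add_diff_eq)
  qed
qed

instantiation torus :: metric_space
begin

lift_definition dist_torus :: "torus \<Rightarrow> torus \<Rightarrow> real" is "\<lambda>x y. dist_to_int (x - y)"
proof -
  fix x x' y y' :: real
  assume "x - x' \<in> \<int>" "y - y' \<in> \<int>"
  then obtain m n where mn: "x - x' = of_int m" "y - y' = of_int n" by (auto elim!: Ints_cases)
  have "x - y = (x' - y') + of_int (m - n)" using mn by simp
  thus "dist_to_int (x - y) = dist_to_int (x' - y')" by (simp only: dist_to_int_add_int)
qed

definition uniformity_torus :: "(torus \<times> torus) filter" where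
  "uniformity_torus = (INF e\<in>{0<..}. principal {(x, y). dist x y < e})"

definition open_torus :: "torus set \<Rightarrow> bool" where
  "open_torus U \<longleftrightarrow> (\<forall>x\<in>U. eventually (\<lambda>(x', y). x' = x \<longrightarrow> y \<in> U) uniformity)"

instance
proof
  show "dist x y = 0 \<longleftrightarrow> x = y" for x y :: torus
    by transfer (rule dist_to_int_eq_0_iff)
  show "dist x y \<le> dist x z + dist y z" for x y z :: torus
  proof transfer
    fix x y z :: real
    show "dist_to_int (x - y) \<le> dist_to_int (x - z) + dist_to_int (y - z)"
      using dist_to_int_triangle[of "x - z" "z - y"] dist_to_int_minus[of "y - z"] by simp
  qed
qed (rule uniformity_torus_def open_torus_def)+

end

lemma dist_torus_of_real: "dist (torus_of_real x) (torus_of_real y) = dist_to_int (x - y)"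
  by transfer (rule refl)

lemma continuous_on_torus_of_real: "continuous_on A torus_of_real"
proof -
  have "dist (torus_of_real x) (torus_of_real y) \<le> dist x y" for x y
    using dist_to_int_le[of "x - y" 0] by (simp add: dist_torus_of_real dist_real_def)
  thus ?thesis unfolding continuous_on_iff by (blast intro: le_less_trans)
qed

lemma measurable_torus_of_real [measurable]: "torus_of_real \<in> borel_measurable borel"
  by (rule borel_measurable_continuous_onI) (rule continuous_on_torus_of_real)

definition torus_uniform :: "torus measure" where
  "torus_uniform = distr (uniform_measure lborel {0..<1}) borel torus_of_real"

lemma prob_space_torus_uniform: "prob_space torus_uniform"
proof -
  have "prob_space (uniform_measure lborel {0..<1 :: real})"
    by (rule prob_space_uniform_measure) (simp_all only: emeasure_lborel_Ico, simp_all)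
  thus ?thesis
    unfolding torus_uniform_def by (rule prob_space.prob_space_distr) (simp add: measurable_torus_of_real)
qed


section \<open>Hausdorff measure and dimension\<close>

(* The convention 0 ^ 0 = 1 for nonempty sets makes the 0-dimensional measure the counting
   measure; note that 0 powr 0 = 0 in HOL. *)
definition hausdorff_gauge :: "real \<Rightarrow> 'a::metric_space set \<Rightarrow> ennreal" where
  "hausdorff_gauge s U =
     (if U = {} then 0 else if s = 0 then 1 else ennreal (diameter U powr s))"

(* The diameter of an unbounded set is an unspecified real, hence the explicit boundedness. *)
definition hausdorff_premeasure :: "real \<Rightarrow> real \<Rightarrow> 'a::metric_space set \<Rightarrow> ennreal" where
  "hausdorff_premeasure \<delta> s A =
     (INF U \<in> {U :: nat \<Rightarrow> 'a set. A \<subseteq> (\<Union>i. U i) \<and> (\<forall>i. bounded (U i) \<and> diameter (U i) \<le> \<delta>)}.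
        \<Sum>i. hausdorff_gauge s (U i))"

definition hausdorff_measure :: "real \<Rightarrow> 'a::metric_space set \<Rightarrow> ennreal" where
  "hausdorff_measure s A = (SUP \<delta>\<in>{0<..}. hausdorff_premeasure \<delta> s A)"

definition hausdorff_dim :: "'a::metric_space set \<Rightarrow> ereal" where
  "hausdorff_dim A = Inf {ereal s | s. 0 \<le> s \<and> hausdorff_measure s A = 0}"


section \<open>The uniformly covered set and the bound on its dimension\<close>

definition uniform_cover_set :: "(nat \<Rightarrow> torus) \<Rightarrow> (nat \<Rightarrow> real) \<Rightarrow> torus set" where
  "uniform_cover_set w r = {y. \<exists>N0. \<forall>N\<ge>N0. \<exists>n\<in>{1..N}. dist (w n) y < r N}"

definition Theta :: "real \<Rightarrow> real \<Rightarrow> real" where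
  "Theta c \<theta> = 2 * c * (\<theta> - 1) * (1 + 1 / \<theta>\<^sup>2)"

definition Delta :: "real \<Rightarrow> real \<Rightarrow> real" where
  "Delta c \<theta> = 2 * c * (\<theta> - 1) * (1 / \<theta> - 1 / \<theta>\<^sup>2)"

definition Lambda :: "real \<Rightarrow> real \<Rightarrow> real" where
  "Lambda c \<theta> = (1 + Theta c \<theta> + Delta c \<theta>) / 2
     + sqrt (((1 + Theta c \<theta> + Delta c \<theta>) / 2)\<^sup>2 - Delta c \<theta>)"

(* Taken in the extended reals, so that the infimum never depends on a boundedness side condition. *)
definition dim_bound :: "real \<Rightarrow> ereal" where
  "dim_bound c = (INF \<theta>\<in>{1<..}. ereal (ln (Lambda c \<theta>) / ln \<theta>))"

end

theory Submission
  imports Defs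
begin

text \<open>
  The sample is inspected at the geometric times \<open>N k = \<lceil>\<theta>\<^sup>k\<rceil>\<close> only, with radii
  \<open>R k = c / \<theta>\<^sup>k \<ge> c / N k\<close>. A uniformly covered point lies, for all large \<open>k\<close>, in some ball of radius
  \<open>R k\<close> around one of the first \<open>N k\<close> sample points, so it suffices to count the balls of generation
  \<open>k\<close> that can still contain a point covered in all earlier generations.

  A sample point that arrives between the times \<open>N k\<close> and \<open>N (k + 1)\<close> is relevant only if its new
  ball of radius \<open>R (k + 1)\<close> meets a relevant old ball of radius \<open>R k\<close>, that is, if its distance to a
  relevant old point is less than \<open>R k + R (k + 1)\<close>. Since about \<open>(\<theta> - 1) \<theta>\<^sup>k\<close> independent points
  arrive, this produces at most \<open>\<Theta> + \<Delta>\<close> new relevant balls per old one on average, and \<open>1 + \<Theta> + \<Delta>\<close> would be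
  the growth rate of a plain count. The refinement distinguishes two types of arrivals. If the
  distance to all relevant old points is at least \<open>R k + R (k + 2)\<close>, then one generation later the ball, shrunk to radius
  \<open>R (k + 2)\<close>, no longer meets the old balls of radius \<open>R k\<close> and dies. Such short-lived arrivals (the
  \<open>fringe\<close>, \<open>\<Delta>\<close> per ball) cover points in their own generation and have descendants, but they do not
  persist; all others (the \<open>core\<close>, \<open>\<Theta>\<close> per ball) are kept for ever. The expected numbers \<open>s\<close> and \<open>d\<close>
  of the two types satisfy \<open>s' \<le> s + \<Theta> (s + d)\<close> and \<open>d' \<le> \<Delta> (s + d)\<close>, a system with the matrix
  \<open>((1 + \<Theta>, \<Theta>), (\<Delta>, \<Delta>))\<close>. Its trace is \<open>1 + \<Theta> + \<Delta>\<close> and its determinant \<open>\<Delta>\<close>, so its leading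
  eigenvalue is \<open>\<Lambda>\<close>.

  The geometric part is \<open>covering_index_in_core_fringe\<close>, the probabilistic part
  \<open>expected_core_fringe_le\<close>. If \<open>s > log \<Lambda> / log \<theta>\<close>, the expected \<open>s\<close>-dimensional cost
  \<open>\<Lambda>\<^sup>k \<theta>\<^sup>-\<^sup>s\<^sup>k\<close> of generation \<open>k\<close> is summable, so the cost tends to \<open>0\<close> almost surely and the
  \<open>s\<close>-dimensional Hausdorff measure vanishes. Rounding \<open>\<theta>\<^sup>k\<close> to an integer enlarges the number of
  arrivals by a factor tending to \<open>1\<close>, which is absorbed by replacing \<open>c\<close> in \<open>\<Theta>\<close> and \<open>\<Delta>\<close> by a
  slightly larger constant, as \<open>\<Lambda>\<close> is continuous in \<open>c\<close>. The limit \<open>c \<rightarrow> 0\<close> follows from \<open>\<Lambda> \<rightarrow> 1\<close> for a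
  fixed \<open>\<theta>\<close>, and the radii \<open>1 / n\<^sup>\<alpha>\<close> with \<open>\<alpha> > 1\<close> are eventually below \<open>c / n\<close> for every \<open>c > 0\<close>.
\<close>

section \<open>The torus and its uniform measure\<close>

text \<open>Second countability makes the distance of two random points measurable.\<close>

instance torus :: second_countable_topology
proof
  define B where "B = (\<lambda>p. ball (torus_of_real (of_rat (fst p))) (of_rat (snd p))) ` (UNIV :: (rat \<times> rat) set)"
  have "topological_basis B"
  proof (rule topological_basisI)
    show "open U" if "U \<in> B" for U
      using that by (auto simp: B_def)
    fix V and x :: torus
    assume "open V" "x \<in> V"
    then obtain e where e: "e > 0" "ball x e \<subseteq> V"
      by (auto simp: open_contains_ball)
    obtain x0 where x0: "x = torus_of_real x0"
      using Quotient3_torus by (metis Quotient3_abs_rep)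
    obtain q where q: "e / 4 < real_of_rat q" "real_of_rat q < e / 2"
      using of_rat_dense[of "e / 4" "e / 2"] e by auto
    obtain p where p: "x0 < real_of_rat p" "real_of_rat p < x0 + e / 4"
      using of_rat_dense[of "x0" "x0 + e / 4"] e by auto
    have d: "dist x (torus_of_real (of_rat p)) < e / 4"
      using dist_to_int_le[of "x0 - of_rat p" 0] p by (simp add: x0 dist_torus_of_real)
    show "\<exists>U\<in>B. x \<in> U \<and> U \<subseteq> V"
    proof (intro bexI conjI)
      show "x \<in> ball (torus_of_real (of_rat p)) (of_rat q)"
        using d q by (simp add: dist_commute)
      show "ball (torus_of_real (of_rat p)) (of_rat q) \<subseteq> V"
      proof
        fix y assume "y \<in> ball (torus_of_real (of_rat p)) (of_rat q)"
        hence "dist x y < e"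
          using d q e dist_triangle[of x y "torus_of_real (of_rat p)"] by auto
        thus "y \<in> V" using e by auto
      qed
      show "ball (torus_of_real (of_rat p)) (of_rat q) \<in> B"
        unfolding B_def by (rule image_eqI[of _ _ "(p, q)"]) auto
    qed
  qed
  moreover have "countable B" unfolding B_def by simp
  ultimately show "\<exists>B::torus set set. countable B \<and> open = generate_topology B"
    using topological_basis_imp_subbasis by blast
qed

lemma torus_of_real_cases:
  obtains x where "0 \<le> x" "x < 1" "p = torus_of_real x"
proof -
  obtain x where x: "p = torus_of_real x"
    using Quotient3_torus by (metis Quotient3_abs_rep)
  have "dist (torus_of_real x) (torus_of_real (frac x)) = 0"
    by (simp add: dist_torus_of_real dist_to_int_eq_0_iff frac_def)
  thus ?thesis using that[of "frac x"] x by (simp add: frac_lt_1)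
qed

lemma dist_to_int_cases:
  assumes "\<bar>u\<bar> < 1"
  shows "dist_to_int u \<in> {u, - u, 1 - u, 1 + u}"
proof -
  have "\<bar>real_of_int (round u)\<bar> < 2"
    using of_int_round_abs_le[of u] assms by linarith
  hence "round u = 0 \<or> round u = 1 \<or> round u = -1" by linarith
  thus ?thesis using assms unfolding dist_to_int_def by (auto simp: abs_if split: if_splits)
qed

text \<open>
  On \<open>[0, 1)\<close> an annulus around \<open>x\<close> consists of at most four intervals: one to the left of \<open>x\<close>, one to
  the right, and the parts of these two that wrap around. An interval and its wrapped part have total
  length at most \<open>b - a\<close>.
\<close>
lemma emeasure_torus_annulus_le:
  assumes "0 \<le> a" "a \<le> b"
  shows "emeasure torus_uniform {y. a \<le> dist p y \<and> dist p y < b} \<le> ennreal (2 * (b - a))"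
proof -
  obtain x where x: "0 \<le> x" "x < 1" "p = torus_of_real x" by (rule torus_of_real_cases)
  define Y where "Y = {y. a \<le> dist p y \<and> dist p y < b}"
  define L where "L = emeasure (lborel :: real measure)"
  \<comment> \<open>\<open>J1\<close> wraps around to \<open>J2\<close>, and \<open>J3\<close> to \<open>J4\<close>; the outer maxima turn an
    empty piece into a single point.\<close>
  define J1 J2 J3 J4 where "J1 = {max 0 (x - b) .. max (max 0 (x - b)) (x - a)}"
    and "J2 = {x + 1 - b .. max (x + 1 - b) (min 1 (x + 1 - a))}"
    and "J3 = {x + a .. max (x + a) (min 1 (x + b))}"
    and "J4 = {max 0 (x - 1 + a) .. max (max 0 (x - 1 + a)) (x - 1 + b)}"
  have Y: "Y \<in> sets borel" unfolding Y_def by measurable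
  have "emeasure torus_uniform Y = emeasure (uniform_measure lborel {0..<1}) (torus_of_real -` Y)"
    unfolding torus_uniform_def using Y by (subst emeasure_distr) (auto simp: measurable_torus_of_real)
  also have "\<dots> = L ({0..<1} \<inter> torus_of_real -` Y)"
    unfolding L_def using measurable_sets[OF measurable_torus_of_real Y]
    by (subst emeasure_uniform_measure) (auto simp: divide_ennreal_def)
  also have "\<dots> \<le> L (J1 \<union> J2 \<union> (J3 \<union> J4))"
    unfolding L_def
  proof (rule emeasure_mono)
    show "{0..<1} \<inter> torus_of_real -` Y \<subseteq> J1 \<union> J2 \<union> (J3 \<union> J4)"
    proof
      fix t assume t: "t \<in> {0..<1} \<inter> torus_of_real -` Y"
      hence "a \<le> dist_to_int (x - t)" "dist_to_int (x - t) < b" "0 \<le> t" "t < 1"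
        by (auto simp: Y_def x dist_torus_of_real)
      moreover have "dist_to_int (x - t) \<in> {x - t, - (x - t), 1 - (x - t), 1 + (x - t)}"
        using x t by (intro dist_to_int_cases) auto
      ultimately show "t \<in> J1 \<union> J2 \<union> (J3 \<union> J4)"
        unfolding J1_def J2_def J3_def J4_def by auto
    qed
  qed (auto simp: J1_def J2_def J3_def J4_def)
  also have "\<dots> \<le> (L J1 + L J2) + (L J3 + L J4)"
    unfolding L_def
    by (intro order_trans[OF emeasure_subadditive] add_mono order_refl)
       (auto simp: J1_def J2_def J3_def J4_def)
  also have "L J1 + L J2 \<le> ennreal (b - a)"
    unfolding L_def J1_def J2_def using assms x
    by (simp add: ennreal_plus[symmetric] del: ennreal_plus)
  also have "L J3 + L J4 \<le> ennreal (b - a)"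
    unfolding L_def J3_def J4_def using assms x
    by (simp add: ennreal_plus[symmetric] del: ennreal_plus)
  finally show ?thesis
    using assms by (simp add: Y_def add_mono ennreal_plus[symmetric] del: ennreal_plus)
qed

section \<open>Hausdorff measure zero\<close>

lemma hausdorff_measure_eq_0I:
  assumes "\<And>\<delta> \<epsilon>. \<delta> > 0 \<Longrightarrow> \<epsilon> > 0 \<Longrightarrow> \<exists>U. A \<subseteq> (\<Union>i::nat. U i) \<and>
     (\<forall>i. bounded (U i) \<and> diameter (U i) \<le> \<delta>) \<and> (\<Sum>i. hausdorff_gauge s (U i)) \<le> ennreal \<epsilon>"
  shows "hausdorff_measure s A = 0"
proof -
  have "hausdorff_premeasure \<delta> s A \<le> 0" if "\<delta> > 0" for \<delta>
  proof (rule ennreal_le_epsilon)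
    fix e :: real assume "e > 0"
    from assms[OF that this] show "hausdorff_premeasure \<delta> s A \<le> 0 + ennreal e"
      unfolding hausdorff_premeasure_def by (auto intro: INF_lower2)
  qed
  thus ?thesis unfolding hausdorff_measure_def by (auto simp: SUP_eq_const intro!: antisym SUP_least)
qed

lemma hausdorff_measure_eq_0D:
  assumes "hausdorff_measure s A = 0" "\<delta> > 0" "\<epsilon> > 0"
  shows "\<exists>U. A \<subseteq> (\<Union>i::nat. U i) \<and>
     (\<forall>i. bounded (U i) \<and> diameter (U i) \<le> \<delta>) \<and> (\<Sum>i. hausdorff_gauge s (U i)) < ennreal \<epsilon>"
proof -
  have "hausdorff_premeasure \<delta> s A \<le> hausdorff_measure s A"
    unfolding hausdorff_measure_def using assms(2) by (intro SUP_upper) auto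
  hence "hausdorff_premeasure \<delta> s A < ennreal \<epsilon>"
    using assms by simp
  thus ?thesis unfolding hausdorff_premeasure_def INF_less_iff by auto
qed

lemma hausdorff_measure_UN_eq_0:
  fixes A :: "nat \<Rightarrow> 'a::metric_space set"
  assumes "\<And>K. hausdorff_measure s (A K) = 0"
  shows "hausdorff_measure s (\<Union>K. A K) = 0"
proof (rule hausdorff_measure_eq_0I)
  fix \<delta> \<epsilon> :: real assume pos: "\<delta> > 0" "\<epsilon> > 0"
  have "\<forall>K. \<exists>U. A K \<subseteq> (\<Union>i::nat. U i) \<and> (\<forall>i. bounded (U i) \<and> diameter (U i) \<le> \<delta>) \<and>
      (\<Sum>i. hausdorff_gauge s (U i)) < ennreal (\<epsilon> * (1 / 2) ^ Suc K)"
    using pos by (intro allI hausdorff_measure_eq_0D[OF assms]) auto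
  then obtain U where U: "\<And>K. A K \<subseteq> (\<Union>i::nat. U K i)"
      "\<And>K i. bounded (U K i) \<and> diameter (U K i) \<le> \<delta>"
      "\<And>K. (\<Sum>i. hausdorff_gauge s (U K i)) < ennreal (\<epsilon> * (1 / 2) ^ Suc K)"
    unfolding choice_iff by blast
  define V where "V = (\<lambda>i. case_prod U (prod_decode i))"
  have "(\<Sum>i. hausdorff_gauge s (V i)) = (\<Sum>K. \<Sum>i. hausdorff_gauge s (U K i))"
    using suminf_ennreal_2dimen[of "\<lambda>K. \<Sum>i. hausdorff_gauge s (U K i)"
        "\<lambda>p. hausdorff_gauge s (case_prod U p)"] by (simp add: V_def)
  also have "\<dots> \<le> (\<Sum>K. ennreal (\<epsilon> * (1 / 2) ^ Suc K))"
    using U(3) by (intro suminf_le) (auto intro: less_imp_le)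
  also have "\<dots> = ennreal \<epsilon>"
    using sums_mult[OF power_half_series, of \<epsilon>] pos by (intro suminf_ennreal_eq) auto
  finally have sum: "(\<Sum>i. hausdorff_gauge s (V i)) \<le> ennreal \<epsilon>" .
  have cov: "(\<Union>K. A K) \<subseteq> (\<Union>i. V i)"
  proof
    fix y assume "y \<in> (\<Union>K. A K)"
    then obtain K i where "y \<in> U K i" using U(1) by blast
    hence "y \<in> V (prod_encode (K, i))" by (simp add: V_def)
    thus "y \<in> (\<Union>i. V i)" by blast
  qed
  show "\<exists>U. (\<Union>K. A K) \<subseteq> (\<Union>i::nat. U i) \<and>
     (\<forall>i. bounded (U i) \<and> diameter (U i) \<le> \<delta>) \<and> (\<Sum>i. hausdorff_gauge s (U i)) \<le> ennreal \<epsilon>"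
    using sum cov U(2) by (intro exI[of _ V]) (auto simp: V_def split: prod.split)
qed

lemma hausdorff_measure_mono:
  assumes "A \<subseteq> B" shows "hausdorff_measure s A \<le> hausdorff_measure s B"
  unfolding hausdorff_measure_def hausdorff_premeasure_def
  using assms by (intro SUP_mono' INF_superset_mono) auto

lemma hausdorff_dim_mono:
  assumes "A \<subseteq> B" shows "hausdorff_dim A \<le> hausdorff_dim B"
  unfolding hausdorff_dim_def
  using hausdorff_measure_mono[OF assms] by (intro Inf_superset_mono) (auto, metis le_zero_eq)

lemma hausdorff_dim_nonneg: "0 \<le> hausdorff_dim A"
  unfolding hausdorff_dim_def by (auto intro!: Inf_greatest)

lemma hausdorff_dim_le:
  assumes "0 \<le> s" "hausdorff_measure s A = 0" shows "hausdorff_dim A \<le> ereal s"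
  unfolding hausdorff_dim_def using assms by (intro Inf_lower) auto

lemma diameter_ball_le:
  fixes x :: "'a::metric_space"
  assumes "0 \<le> r" shows "diameter (ball x r) \<le> 2 * r"
proof (cases "ball x r = {}")
  case False
  have "dist y z \<le> 2 * r" if "y \<in> ball x r" "z \<in> ball x r" for y z
    using that dist_triangle3[of y z x] by auto
  thus ?thesis using False unfolding diameter_def by (auto intro!: cSUP_least)
qed (use assms in \<open>simp add: diameter_def\<close>)

text \<open>
  The cover by the balls indexed by \<open>F k\<close> costs at most \<open>2\<^sup>s\<close> times the quantity assumed to tend to
  \<open>0\<close>; a single large \<open>k\<close> therefore serves any prescribed mesh and cost.
\<close>
lemma hausdorff_measure_eq_0_if_covers:
  fixes A :: "'a::metric_space set" and F :: "nat \<Rightarrow> nat set" and z :: "nat \<Rightarrow> 'a"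
  assumes s: "0 < s" and fin: "\<And>k. finite (F k)" and R: "\<And>k. 0 < R k" "R \<longlonglongrightarrow> 0"
    and cov: "\<And>k. A \<subseteq> (\<Union>n\<in>F k. ball (z n) (R k))"
    and lim: "(\<lambda>k. real (card (F k)) * R k powr s) \<longlonglongrightarrow> 0"
  shows "hausdorff_measure s A = 0"
proof (rule hausdorff_measure_eq_0I)
  fix \<delta> \<epsilon> :: real assume pos: "\<delta> > 0" "\<epsilon> > 0"
  have "eventually (\<lambda>k. R k < \<delta> / 2) sequentially"
    using order_tendstoD(2)[OF R(2), of "\<delta> / 2"] pos by simp
  moreover have "eventually (\<lambda>k. real (card (F k)) * R k powr s < \<epsilon> / 2 powr s) sequentially"
    using order_tendstoD(2)[OF lim, of "\<epsilon> / 2 powr s"] pos by simp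
  ultimately have "eventually (\<lambda>k. R k < \<delta> / 2 \<and> real (card (F k)) * R k powr s < \<epsilon> / 2 powr s) sequentially"
    by (rule eventually_conj)
  then obtain k where k: "R k < \<delta> / 2" "real (card (F k)) * R k powr s < \<epsilon> / 2 powr s"
    unfolding eventually_sequentially by blast
  define V where "V = (\<lambda>n. if n \<in> F k then ball (z n) (R k) else {})"
  have "hausdorff_gauge s (V n) \<le> ennreal ((2 * R k) powr s)" for n
    using s R(1)[of k] diameter_ball_le[of "R k" "z n"]
    by (auto simp: hausdorff_gauge_def V_def intro!: ennreal_leI powr_mono2 diameter_ge_0)
  hence "(\<Sum>n\<in>F k. hausdorff_gauge s (V n)) \<le> (\<Sum>n\<in>F k. ennreal ((2 * R k) powr s))"
    by (intro sum_mono)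
  also have "\<dots> = ennreal (real (card (F k)) * (2 * R k) powr s)"
    by (simp add: ennreal_mult ennreal_of_nat_eq_real_of_nat)
  also have "\<dots> \<le> ennreal \<epsilon>"
    using k(2) R(1)[of k] by (intro ennreal_leI) (simp add: powr_mult field_simps)
  also have "(\<Sum>n\<in>F k. hausdorff_gauge s (V n)) = (\<Sum>n. hausdorff_gauge s (V n))"
    using fin by (intro suminf_finite[symmetric]) (auto simp: V_def hausdorff_gauge_def)
  finally have "(\<Sum>n. hausdorff_gauge s (V n)) \<le> ennreal \<epsilon>" .
  moreover have "A \<subseteq> (\<Union>n. V n)" using cov[of k] by (force simp: V_def)
  moreover have "bounded (V n) \<and> diameter (V n) \<le> \<delta>" for n
    using diameter_ball_le[of "R k" "z n"] k R(1)[of k] pos by (auto simp: V_def)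
  ultimately show "\<exists>U. A \<subseteq> (\<Union>i::nat. U i) \<and>
     (\<forall>i. bounded (U i) \<and> diameter (U i) \<le> \<delta>) \<and> (\<Sum>i. hausdorff_gauge s (U i)) \<le> ennreal \<epsilon>"
    by blast
qed

section \<open>Independent points in an annulus\<close>

text \<open>
  Fubini: conditionally on \<open>X\<close>, the uniform point \<open>g (Y x)\<close> hits the annulus around \<open>f (X x)\<close> with
  probability at most \<open>2 * (b - a)\<close>. In the application \<open>X\<close> collects the sample points seen so far,
  \<open>Q\<close> says that one of them, selected by \<open>f\<close>, is relevant, and \<open>Y\<close> is a later point; both are
  restrictions of the whole sequence, which is why \<open>Y\<close> is followed by a projection \<open>g\<close>.
\<close>
lemma (in prob_space) prob_indep_annulus_le:
  fixes X Y :: "'a \<Rightarrow> 'b" and f g :: "'b \<Rightarrow> torus"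
  assumes indep: "indep_var S X T Y" and Y: "distr M borel (\<lambda>x. g (Y x)) = torus_uniform"
    and f: "f \<in> borel_measurable S" and g: "g \<in> borel_measurable T"
    and Q: "Q \<in> sets S" and ab: "0 \<le> a" "a \<le> b"
  shows "prob {x \<in> space M. X x \<in> Q \<and> a \<le> dist (f (X x)) (g (Y x)) \<and> dist (f (X x)) (g (Y x)) < b}
     \<le> 2 * (b - a) * prob {x \<in> space M. X x \<in> Q}"
proof -
  have rv [measurable]: "X \<in> measurable M S" "Y \<in> measurable M T"
    using indep by (auto simp: indep_var_distribution_eq)
  note [measurable] = f g Q
  interpret T: prob_space "distr M T Y" by (rule prob_space_distr) simp
  define W where "W = {p \<in> space (S \<Otimes>\<^sub>M T). fst p \<in> Q \<and> a \<le> dist (f (fst p)) (g (snd p)) \<and> dist (f (fst p)) (g (snd p)) < b}"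
  have W[measurable]: "W \<in> sets (S \<Otimes>\<^sub>M T)" unfolding W_def by measurable
  have "emeasure M {x \<in> space M. X x \<in> Q \<and> a \<le> dist (f (X x)) (g (Y x)) \<and> dist (f (X x)) (g (Y x)) < b}
      = emeasure (distr M (S \<Otimes>\<^sub>M T) (\<lambda>x. (X x, Y x))) W"
    using measurable_space[OF rv(1)] measurable_space[OF rv(2)]
    by (subst emeasure_distr) (auto simp: W_def space_pair_measure intro!: arg_cong[of _ _ "emeasure M"])
  also have "\<dots> = emeasure (distr M S X \<Otimes>\<^sub>M distr M T Y) W"
    using indep by (simp add: indep_var_distribution_eq)
  also have "\<dots> = (\<integral>\<^sup>+ x. emeasure (distr M T Y) (Pair x -` W) \<partial>distr M S X)"
    using W by (intro T.emeasure_pair_measure_alt) simp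
  also have "\<dots> \<le> (\<integral>\<^sup>+ x. ennreal (2 * (b - a)) * indicator Q x \<partial>distr M S X)"
  proof (rule nn_integral_mono)
    fix x assume "x \<in> space (distr M S X)"
    show "emeasure (distr M T Y) (Pair x -` W) \<le> ennreal (2 * (b - a)) * indicator Q x"
    proof (cases "x \<in> Q")
      case True
      define V where "V = {y. a \<le> dist (f x) y \<and> dist (f x) y < b}"
      have V [measurable]: "V \<in> sets borel" unfolding V_def by measurable
      have "emeasure (distr M T Y) (Pair x -` W) \<le> emeasure (distr M T Y) (g -` V \<inter> space T)"
        by (intro emeasure_mono) (auto simp: W_def V_def space_pair_measure)
      also have "\<dots> = emeasure (distr (distr M T Y) borel g) V"
        by (subst emeasure_distr) auto
      also have "distr (distr M T Y) borel g = torus_uniform"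
        by (subst distr_distr) (auto simp: comp_def Y)
      also have "emeasure torus_uniform V \<le> ennreal (2 * (b - a))"
        unfolding V_def using ab by (rule emeasure_torus_annulus_le)
      finally show ?thesis using True by simp
    next
      case False
      hence "Pair x -` W = {}" by (auto simp: W_def)
      thus ?thesis by simp
    qed
  qed
  also have "\<dots> = ennreal (2 * (b - a)) * emeasure (distr M S X) Q"
    by (subst nn_integral_cmult_indicator) auto
  also have "emeasure (distr M S X) Q = emeasure M {x \<in> space M. X x \<in> Q}"
    by (subst emeasure_distr) (auto intro!: arg_cong[of _ _ "emeasure M"])
  finally show ?thesis
    using ab by (simp add: emeasure_eq_measure ennreal_mult[symmetric])
qed

section \<open>Relevant indices\<close>

text \<open>
  An arrival that is close to one relevant old point and in the outer annulus of another belongs to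
  both sets. This keeps the \<open>fringe\<close> a plain union of annuli, at the price of counting such an index
  twice. An index of the \<open>fringe\<close> is not carried over to the next generation unless it is also in
  the \<open>core\<close>.
\<close>
fun core fringe :: "(nat \<Rightarrow> 'b::metric_space) \<Rightarrow> (nat \<Rightarrow> nat) \<Rightarrow> (nat \<Rightarrow> real) \<Rightarrow> nat \<Rightarrow> nat set" where
  "core w N R 0 = {1..N 0}"
| "core w N R (Suc k) = core w N R k \<union> {m \<in> {N k<..N (Suc k)}.
     \<exists>n\<in>core w N R k \<union> fringe w N R k. dist (w n) (w m) < R k + R (k + 2)}"
| "fringe w N R 0 = {}"
| "fringe w N R (Suc k) = {m \<in> {N k<..N (Suc k)}.
     \<exists>n\<in>core w N R k \<union> fringe w N R k.
       R k + R (k + 2) \<le> dist (w n) (w m) \<and> dist (w n) (w m) < R k + R (k + 1)}"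

lemma core_subset_fringe_subset:
  assumes "mono N"
  shows "core w N R k \<subseteq> {1..N k}" "fringe w N R k \<subseteq> {1..N k}"
proof (induction k)
  case (Suc k)
  have "N k \<le> N (Suc k)" using assms by (simp add: monoD)
  {
    case 1 show ?case using Suc \<open>N k \<le> N (Suc k)\<close> by fastforce
  next
    case 2 show ?case using Suc \<open>N k \<le> N (Suc k)\<close> by auto
  }
qed auto

text \<open>
  The relevant indices of generation \<open>k\<close> are determined by the first \<open>N k\<close> sample points, hence are
  independent of later arrivals.
\<close>
lemma core_fringe_cong:
  assumes "mono N" and "\<And>n. n \<in> {1..N k} \<Longrightarrow> v n = w n"
  shows "core v N R k = core w N R k \<and> fringe v N R k = fringe w N R k"
  using assms(2)
proof (induction k)
  case (Suc k)
  have le: "N k \<le> N (Suc k)" using assms by (simp add: monoD)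
  hence IH: "core v N R k = core w N R k" "fringe v N R k = fringe w N R k"
    using Suc by auto
  have "v n = w n" if "n \<in> core w N R k \<union> fringe w N R k" for n
    using that core_subset_fringe_subset[OF assms(1), of w R k] Suc.prems le by fastforce
  moreover have "v m = w m" if "m \<in> {N k<..N (Suc k)}" for m
    using that Suc.prems by auto
  ultimately show ?case by (auto simp: IH)
qed auto

text \<open>
  Let \<open>y\<close> be covered in all generations up to \<open>k\<close>. By induction, all balls that contain \<open>y\<close> in an
  earlier generation are relevant. A new ball around \<open>w n\<close> containing \<open>y\<close> meets such a ball of the
  preceding generation, so \<open>n\<close> is in the \<open>core\<close> or in the \<open>fringe\<close>. An old one already contained
  \<open>y\<close> with its former, larger radius and was therefore relevant; it could only have been dropped as
  an index that belongs to the \<open>fringe\<close> alone. Then it arrived in generation \<open>i + 1\<close>, where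
  \<open>k = i + 2\<close>, at distance at least \<open>R i + R (i + 2)\<close> from every relevant index of generation \<open>i\<close>. One
  of these is within \<open>R i\<close> of \<open>y\<close>, contradicting \<open>dist (w n) y < R k\<close>.
\<close>
lemma covering_index_in_core_fringe:
  assumes "decseq R"
    and "\<And>j. j \<le> k \<Longrightarrow> y \<in> (\<Union>n\<in>{1..N j}. ball (w n) (R j))"
    and "n \<in> {1..N k}" "dist (w n) y < R k"
  shows "n \<in> core w N R k \<union> fringe w N R k"
  using assms(2-)
proof (induction k arbitrary: n rule: less_induct)
  case (less k)
  have active: "\<exists>m\<in>core w N R j \<union> fringe w N R j. dist (w m) y < R j" if j: "j < k" for j
  proof -
    obtain m where "m \<in> {1..N j}" "dist (w m) y < R j" using less.prems(1)[of j] j by auto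
    moreover have "\<And>i. i \<le> j \<Longrightarrow> y \<in> (\<Union>n\<in>{1..N i}. ball (w n) (R i))"
      using less.prems(1) j by simp
    ultimately show ?thesis using less.IH[OF j, of m] by blast
  qed
  show ?case
  proof (cases k)
    case 0
    thus ?thesis using less.prems by simp
  next
    case (Suc j)
    show ?thesis
    proof (cases "n \<le> N j")
      case old: True
      have "R (Suc j) \<le> R j" using assms(1) by (simp add: decseqD)
      hence "dist (w n) y < R j" using less.prems(3) Suc by simp
      moreover have "\<And>i. i \<le> j \<Longrightarrow> y \<in> (\<Union>n\<in>{1..N i}. ball (w n) (R i))"
        using less.prems(1) Suc by simp
      ultimately have "n \<in> core w N R j \<union> fringe w N R j"
        using less.IH[of j n] old less.prems(2) Suc by auto
      moreover have "n \<notin> fringe w N R j - core w N R j"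
      proof
        assume n: "n \<in> fringe w N R j - core w N R j"
        then obtain i where i: "j = Suc i" by (cases j) auto
        obtain m where m: "m \<in> core w N R i \<union> fringe w N R i" "dist (w m) y < R i"
          using active[of i] i Suc by auto
        have "R i + R (i + 2) \<le> dist (w m) (w n)" using n m(1) by (auto simp: i not_less)
        also have "\<dots> \<le> dist (w m) y + dist (w n) y" by (rule dist_triangle2)
        also have "\<dots> < R i + R (i + 2)" using m(2) less.prems(3) Suc i by simp
        finally show False by simp
      qed
      ultimately show ?thesis using Suc by auto
    next
      case new: False
      obtain m where m: "m \<in> core w N R j \<union> fringe w N R j" "dist (w m) y < R j"
        using active[of j] Suc by auto
      have "dist (w m) (w n) \<le> dist (w m) y + dist (w n) y" by (rule dist_triangle2)
      also have "\<dots> < R j + R (j + 1)" using m(2) less.prems(3) Suc by simp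
      finally show ?thesis using m(1) new less.prems(2) Suc
        by (cases "dist (w m) (w n) < R j + R (j + 2)") (auto simp: not_less)
    qed
  qed
qed

text \<open>
  Both predicates are proved measurable simultaneously since the recursions are intertwined. The
  quantifier over relevant indices is turned into one over the fixed finite set \<open>{1..N k}\<close>.
\<close>
lemma pred_core_fringe:
  fixes N :: "nat \<Rightarrow> nat"
  assumes "mono N" "{1..N k} \<subseteq> I"
  shows "Measurable.pred (Pi\<^sub>M I (\<lambda>_. borel :: torus measure)) (\<lambda>v. n \<in> core v N R k) \<and>
    Measurable.pred (Pi\<^sub>M I (\<lambda>_. borel :: torus measure)) (\<lambda>v. n \<in> fringe v N R k)"
  using assms(2)
proof (induction k arbitrary: n)
  case (Suc k)
  let ?P = "Pi\<^sub>M I (\<lambda>_. borel :: torus measure)"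
  have le: "N k \<le> N (Suc k)" using assms by (simp add: monoD)
  have act: "Measurable.pred ?P (\<lambda>v. n \<in> core v N R k \<union> fringe v N R k)" for n
  proof -
    have "Measurable.pred ?P (\<lambda>v. n \<in> core v N R k \<or> n \<in> fringe v N R k)"
      using Suc.prems le by (intro pred_intros_logic Suc.IH[THEN conjunct1] Suc.IH[THEN conjunct2]) auto
    thus ?thesis by (simp add: Un_iff)
  qed
  have comp: "(\<lambda>v. v i) \<in> borel_measurable ?P" if "i \<in> {1..N (Suc k)}" for i
    using that Suc.prems(1) by (intro measurable_component_singleton) auto
  have link: "Measurable.pred ?P (\<lambda>v. \<exists>i\<in>core v N R k \<union> fringe v N R k. a \<le> dist (v i) (v n) \<and> dist (v i) (v n) < b)"
    if n: "n \<in> {N k<..N (Suc k)}" for a b n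
  proof -
    have "Measurable.pred ?P (\<lambda>v. \<exists>i\<in>{1..N k}. i \<in> core v N R k \<union> fringe v N R k \<and> a \<le> dist (v i) (v n) \<and> dist (v i) (v n) < b)"
    proof (intro pred_intros_finite)
      fix i assume "i \<in> {1..N k}"
      hence [measurable]: "(\<lambda>v. v i) \<in> borel_measurable ?P" "(\<lambda>v. v n) \<in> borel_measurable ?P"
        using n le by (auto intro!: comp)
      note [measurable] = act[of i]
      show "Measurable.pred ?P (\<lambda>v. i \<in> core v N R k \<union> fringe v N R k \<and> a \<le> dist (v i) (v n) \<and> dist (v i) (v n) < b)"
        by measurable
    qed auto
    moreover have "(\<exists>i\<in>{1..N k}. i \<in> core v N R k \<union> fringe v N R k \<and> a \<le> dist (v i) (v n) \<and> dist (v i) (v n) < b)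
        \<longleftrightarrow> (\<exists>i\<in>core v N R k \<union> fringe v N R k. a \<le> dist (v i) (v n) \<and> dist (v i) (v n) < b)" for v :: "nat \<Rightarrow> torus"
      using core_subset_fringe_subset[OF assms(1), of v R k] by blast
    ultimately show ?thesis by simp
  qed
  show ?case
  proof (cases "n \<in> {N k<..N (Suc k)}")
    case True
    have "Measurable.pred ?P (\<lambda>v. n \<in> core v N R k \<or> (\<exists>i\<in>core v N R k \<union> fringe v N R k. 0 \<le> dist (v i) (v n) \<and> dist (v i) (v n) < R k + R (k + 2)))"
      using Suc.prems le by (intro pred_intros_logic Suc.IH[THEN conjunct1] link True) auto
    moreover have "Measurable.pred ?P (\<lambda>v. (\<exists>i\<in>core v N R k \<union> fringe v N R k. R k + R (k + 2) \<le> dist (v i) (v n) \<and> dist (v i) (v n) < R k + R (k + 1)))"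
      by (intro link True)
    ultimately show ?thesis using True by simp
  next
    case False
    have old: "Measurable.pred ?P (\<lambda>v. n \<in> core v N R k)"
      using Suc.prems le by (intro Suc.IH[THEN conjunct1]) auto
    have eq: "(n \<in> core v N R (Suc k)) = (n \<in> core v N R k)" "(n \<in> fringe v N R (Suc k)) = False" for v :: "nat \<Rightarrow> torus"
      using False by auto
    show ?thesis unfolding eq using old by simp
  qed
qed auto

section \<open>Expected number of relevant indices\<close>

text \<open>
  The weights \<open>(L, L - 1)\<close> form a left eigenvector of the recursion matrix \<open>((1 + T, T), (D, D))\<close>
  for its eigenvalue \<open>L\<close>, so \<open>L * s k + (L - 1) * d k\<close> grows at most by the factor \<open>L\<close> in each step.
\<close>
lemma two_type_growth:
  fixes s d :: "nat \<Rightarrow> real"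
  assumes nn: "\<And>k. 0 \<le> s k" "\<And>k. 0 \<le> d k"
    and s: "\<And>k. s (Suc k) \<le> s k + T * (s k + d k)" and d: "\<And>k. d (Suc k) \<le> D * (s k + d k)"
    and L: "1 < L" "L * (1 + T) + (L - 1) * D \<le> L\<^sup>2"
  shows "s k + d k \<le> (L * s 0 + (L - 1) * d 0) / (L - 1) * L ^ k"
proof -
  have "L * s k + (L - 1) * d k \<le> (L * s 0 + (L - 1) * d 0) * L ^ k"
  proof (induction k)
    case (Suc k)
    have "L * s (Suc k) + (L - 1) * d (Suc k) \<le> L * (s k + T * (s k + d k)) + (L - 1) * (D * (s k + d k))"
      using L(1) s d by (intro add_mono mult_left_mono) auto
    also have "\<dots> = (L * (1 + T) + (L - 1) * D) * s k + (L * (1 + T) + (L - 1) * D - L) * d k"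
      by (simp add: algebra_simps)
    also have "\<dots> \<le> L\<^sup>2 * s k + (L\<^sup>2 - L) * d k"
      using L nn by (intro add_mono mult_right_mono) auto
    also have "\<dots> = L * (L * s k + (L - 1) * d k)" by (simp add: algebra_simps power2_eq_square)
    also have "\<dots> \<le> L * ((L * s 0 + (L - 1) * d 0) * L ^ k)"
      using Suc L by (intro mult_left_mono) auto
    finally show ?case by (simp add: algebra_simps)
  qed simp
  moreover have "(L - 1) * (s k + d k) \<le> L * s k + (L - 1) * d k"
    using nn(1)[of k] by (simp add: algebra_simps)
  ultimately show ?thesis using L(1) by (simp add: field_simps)
qed

lemma (in prob_space) core_fringe_events:
  fixes \<omega> :: "nat \<Rightarrow> 'a \<Rightarrow> torus" and N :: "nat \<Rightarrow> nat"
  assumes indep: "indep_vars (\<lambda>_. borel) \<omega> {1..}" and N: "mono N"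
  shows "{x \<in> space M. n \<in> core (\<lambda>i. \<omega> i x) N R k} \<in> events"
    and "{x \<in> space M. n \<in> fringe (\<lambda>i. \<omega> i x) N R k} \<in> events"
proof -
  define X where "X = (\<lambda>x. restrict (\<lambda>i. \<omega> i x) {1..N k})"
  have X: "X \<in> measurable M (Pi\<^sub>M {1..N k} (\<lambda>_. borel))"
    unfolding X_def using indep by (intro measurable_restrict) (auto simp: indep_vars_def)
  have cong: "core (X x) N R k = core (\<lambda>i. \<omega> i x) N R k" "fringe (X x) N R k = fringe (\<lambda>i. \<omega> i x) N R k" for x
    using core_fringe_cong[OF N, of k "X x" "\<lambda>i. \<omega> i x"] by (auto simp: X_def)
  show "{x \<in> space M. n \<in> core (\<lambda>i. \<omega> i x) N R k} \<in> events"
    using measurable_compose[OF X pred_core_fringe[OF N order_refl, THEN conjunct1, of n R]] by (simp add: cong pred_def)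
  show "{x \<in> space M. n \<in> fringe (\<lambda>i. \<omega> i x) N R k} \<in> events"
    using measurable_compose[OF X pred_core_fringe[OF N order_refl, THEN conjunct2, of n R]] by (simp add: cong pred_def)
qed

text \<open>
  \<open>T\<close> and \<open>D\<close> bound the mean numbers of \<open>core\<close> and \<open>fringe\<close> arrivals per relevant old index: the number
  of arrivals times the measure of the ball of radius \<open>R k + R (k + 2)\<close>, respectively of the annulus
  between this radius and \<open>R k + R (k + 1)\<close>. The sum on the left is the expected number of relevant
  indices.
\<close>
lemma (in prob_space) expected_core_fringe_le:
  fixes \<omega> :: "nat \<Rightarrow> 'a \<Rightarrow> torus" and N :: "nat \<Rightarrow> nat"
  assumes indep: "indep_vars (\<lambda>_. borel) \<omega> {1..}"
    and unif: "\<And>n. n \<ge> 1 \<Longrightarrow> distr M borel (\<omega> n) = torus_uniform"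
    and N: "mono N" and R: "decseq R" "\<And>k. 0 \<le> R k"
    and T: "\<And>k. (real (N (Suc k)) - real (N k)) * (2 * (R k + R (k + 2))) \<le> T"
    and D: "\<And>k. (real (N (Suc k)) - real (N k)) * (2 * (R (k + 1) - R (k + 2))) \<le> D"
    and L: "1 < L" "L * (1 + T) + (L - 1) * D \<le> L\<^sup>2"
  shows "(\<Sum>n\<in>{1..N k}. prob {x \<in> space M. n \<in> core (\<lambda>i. \<omega> i x) N R k \<union> fringe (\<lambda>i. \<omega> i x) N R k})
     \<le> L * real (N 0) / (L - 1) * L ^ k"
proof -
  define C where "C = (\<lambda>k n. {x \<in> space M. n \<in> core (\<lambda>i. \<omega> i x) N R k})"
  define F where "F = (\<lambda>k n. {x \<in> space M. n \<in> fringe (\<lambda>i. \<omega> i x) N R k})"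
  define X where "X = (\<lambda>k x. restrict (\<lambda>i. \<omega> i x) {1..N k})"
  let ?P = "\<lambda>k. Pi\<^sub>M {1..N k} (\<lambda>_. borel :: torus measure)"
  have rv: "\<omega> n \<in> borel_measurable M" if "n \<ge> 1" for n
    using indep that by (auto simp: indep_vars_def)
  have X: "X k \<in> measurable M (?P k)" for k
    unfolding X_def by (intro measurable_restrict rv) auto
  have cong: "core (X k x) N R k = core (\<lambda>i. \<omega> i x) N R k" "fringe (X k x) N R k = fringe (\<lambda>i. \<omega> i x) N R k" for k x
    using core_fringe_cong[OF N, of k "X k x" "\<lambda>i. \<omega> i x"] by (auto simp: X_def)
  have pcf: "Measurable.pred (?P k) (\<lambda>v. n \<in> core v N R k)" "Measurable.pred (?P k) (\<lambda>v. n \<in> fringe v N R k)" for k n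
    using pred_core_fringe[OF N order_refl] by blast+
  have meas: "C k n \<in> events" "F k n \<in> events" for k n
    unfolding C_def F_def using core_fringe_events[OF indep N] by blast+
  define s where "s = (\<lambda>k. \<Sum>n\<in>{1..N k}. prob (C k n))"
  define d where "d = (\<lambda>k. \<Sum>n\<in>{1..N k}. prob (F k n))"
  have CF: "prob (C k n \<union> F k n) \<le> prob (C k n) + prob (F k n)" for k n
    using meas by (intro measure_Un_le) auto
  \<comment> \<open>Union bound over the relevant old index \<open>n\<close>, using that the arrival \<open>m\<close> is independent of it.\<close>
  have link: "prob H \<le> 2 * (b - a) * (s k + d k)"
    if m: "m > N k" and ab: "0 \<le> a" "a \<le> b"
      and H: "H \<subseteq> {x \<in> space M. \<exists>n\<in>core (\<lambda>i. \<omega> i x) N R k \<union> fringe (\<lambda>i. \<omega> i x) N R k.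
        a \<le> dist (\<omega> n x) (\<omega> m x) \<and> dist (\<omega> n x) (\<omega> m x) < b}" for m k a b H
  proof -
    define Q where "Q = (\<lambda>n. {v \<in> space (?P k). n \<in> core v N R k \<union> fringe v N R k})"
    have Q: "Q n \<in> sets (?P k)" for n
    proof -
      have "Q n = {v \<in> space (?P k). n \<in> core v N R k} \<union> {v \<in> space (?P k). n \<in> fringe v N R k}"
        by (auto simp: Q_def)
      thus ?thesis using pcf[of n k] by (simp add: pred_def)
    qed
    have XQ: "X k x \<in> Q n \<longleftrightarrow> n \<in> core (\<lambda>i. \<omega> i x) N R k \<union> fringe (\<lambda>i. \<omega> i x) N R k" if "x \<in> space M" for x n
      using measurable_space[OF X that] by (simp add: Q_def cong)
    define G where "G = (\<lambda>n. {x \<in> space M. X k x \<in> Q n \<and> a \<le> dist (X k x n) (\<omega> m x) \<and> dist (X k x n) (\<omega> m x) < b})"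
    have ind: "indep_var (?P k) (X k) (Pi\<^sub>M {m} (\<lambda>_. borel)) (\<lambda>x. restrict (\<lambda>i. \<omega> i x) {m})"
      unfolding X_def by (rule indep_var_restrict[OF indep]) (use m in auto)
    have dm: "distr M borel (\<lambda>x. restrict (\<lambda>i. \<omega> i x) {m} m) = torus_uniform"
      using unif[of m] m by simp
    have pm: "(\<lambda>v. v m) \<in> borel_measurable (Pi\<^sub>M {m} (\<lambda>_. borel :: torus measure))"
      by (rule measurable_component_singleton) simp
    have comp: "(\<lambda>v. v n) \<in> borel_measurable (?P k)" if "n \<in> {1..N k}" for n
      using that by (rule measurable_component_singleton)
    have G: "G n \<in> events" if n: "n \<in> {1..N k}" for n
    proof -
      have 1: "{x \<in> space M. X k x \<in> Q n} \<in> events"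
        using measurable_sets[OF X Q] by (simp add: vimage_def Int_def conj_commute)
      have [measurable]: "(\<lambda>x. X k x n) \<in> borel_measurable M" "\<omega> m \<in> borel_measurable M"
        using measurable_compose[OF X comp[OF n]] rv[of m] m by auto
      have "{x \<in> space M. a \<le> dist (X k x n) (\<omega> m x) \<and> dist (X k x n) (\<omega> m x) < b} \<in> events"
        by measurable
      from sets.Int[OF 1 this] show ?thesis by (simp add: G_def Int_def conj_commute conj_left_commute cong: conj_cong)
    qed
    have "H \<subseteq> (\<Union>n\<in>{1..N k}. G n)"
    proof
      fix x assume "x \<in> H"
      then obtain n where n: "x \<in> space M" "n \<in> core (\<lambda>i. \<omega> i x) N R k \<union> fringe (\<lambda>i. \<omega> i x) N R k"
        "a \<le> dist (\<omega> n x) (\<omega> m x)" "dist (\<omega> n x) (\<omega> m x) < b" using H by blast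
      hence "n \<in> {1..N k}"
        using core_subset_fringe_subset[OF N, of "\<lambda>i. \<omega> i x" R k] by blast
      moreover have "X k x n = \<omega> n x" using \<open>n \<in> {1..N k}\<close> by (simp add: X_def)
      ultimately have "x \<in> G n" using n XQ[of x n] by (simp add: G_def)
      thus "x \<in> (\<Union>n\<in>{1..N k}. G n)" using \<open>n \<in> {1..N k}\<close> by blast
    qed
    hence "prob H \<le> prob (\<Union>n\<in>{1..N k}. G n)"
      using G by (intro finite_measure_mono) auto
    also have "\<dots> \<le> (\<Sum>n\<in>{1..N k}. prob (G n))"
      using G by (intro finite_measure_subadditive_finite) auto
    also have "\<dots> \<le> (\<Sum>n\<in>{1..N k}. 2 * (b - a) * (prob (C k n) + prob (F k n)))"
    proof (rule sum_mono)
      fix n assume n: "n \<in> {1..N k}"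
      have "prob (G n) \<le> 2 * (b - a) * prob {x \<in> space M. X k x \<in> Q n}"
        using prob_indep_annulus_le[OF ind dm comp[OF n] pm Q[of n] ab] by (simp add: G_def)
      also have "{x \<in> space M. X k x \<in> Q n} = C k n \<union> F k n"
        using XQ by (auto simp: C_def F_def)
      also have "2 * (b - a) * prob (C k n \<union> F k n) \<le> 2 * (b - a) * (prob (C k n) + prob (F k n))"
        using CF ab by (intro mult_left_mono) auto
      finally show "prob (G n) \<le> 2 * (b - a) * (prob (C k n) + prob (F k n))" .
    qed
    also have "\<dots> = 2 * (b - a) * (s k + d k)"
      by (simp add: s_def d_def sum_distrib_left sum.distrib distrib_left)
    finally show ?thesis .
  qed
  have nn: "0 \<le> s k" "0 \<le> d k" for k by (auto simp: s_def d_def intro!: sum_nonneg)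
  have le: "N k \<le> N (Suc k)" for k using N by (simp add: monoD)
  have split: "{1..N (Suc k)} = {1..N k} \<union> {N k<..N (Suc k)}" for k using le[of k] by auto
  have step: "(\<Sum>m\<in>{N k<..N (Suc k)}. g m) \<le> B * (s k + d k)"
    if "\<And>m. m > N k \<Longrightarrow> g m \<le> h * (s k + d k)" "(real (N (Suc k)) - real (N k)) * h \<le> B" for g h B k
  proof -
    have "(\<Sum>m\<in>{N k<..N (Suc k)}. g m) \<le> (\<Sum>m\<in>{N k<..N (Suc k)}. h * (s k + d k))"
      using that by (intro sum_mono) auto
    also have "\<dots> = (real (N (Suc k)) - real (N k)) * h * (s k + d k)"
      using le[of k] by (simp add: of_nat_diff)
    also have "\<dots> \<le> B * (s k + d k)" using that(2) nn by (intro mult_right_mono) auto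
    finally show ?thesis .
  qed
  have subs: "core (\<lambda>i. \<omega> i x) N R k \<subseteq> {1..N k}" for x k
    by (rule core_subset_fringe_subset[OF N])
  have s_Suc: "s (Suc k) \<le> s k + T * (s k + d k)" for k
  proof -
    have old: "C (Suc k) n = C k n" if "n \<in> {1..N k}" for n using that by (auto simp: C_def)
    have new: "prob (C (Suc k) m) \<le> 2 * (R k + R (k + 2)) * (s k + d k)" if m: "m > N k" for m
      using link[OF m, of 0 "R k + R (k + 2)" "C (Suc k) m"] R(2)[of k] R(2)[of "k + 2"] subs[of _ k] m
      by (fastforce simp: C_def)
    have "s (Suc k) = (\<Sum>n\<in>{1..N k}. prob (C (Suc k) n)) + (\<Sum>n\<in>{N k<..N (Suc k)}. prob (C (Suc k) n))"
      unfolding s_def split by (rule sum.union_disjoint) auto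
    also have "(\<Sum>n\<in>{1..N k}. prob (C (Suc k) n)) = s k"
      unfolding s_def by (intro sum.cong) (simp_all add: old)
    also have "(\<Sum>n\<in>{N k<..N (Suc k)}. prob (C (Suc k) n)) \<le> T * (s k + d k)"
      by (rule step[OF new T])
    finally show ?thesis by simp
  qed
  have d_Suc: "d (Suc k) \<le> D * (s k + d k)" for k
  proof -
    have old: "F (Suc k) n = {}" if "n \<in> {1..N k}" for n using that by (auto simp: F_def)
    have new: "prob (F (Suc k) m) \<le> 2 * (R (k + 1) - R (k + 2)) * (s k + d k)" if m: "m > N k" for m
      using link[OF m, of "R k + R (k + 2)" "R k + R (k + 1)" "F (Suc k) m"] R(2)[of k] R(2)[of "k + 2"]
        decseqD[OF R(1), of "k + 1" "k + 2"]
      by (fastforce simp: F_def)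
    have "d (Suc k) = (\<Sum>n\<in>{1..N k}. prob (F (Suc k) n)) + (\<Sum>n\<in>{N k<..N (Suc k)}. prob (F (Suc k) n))"
      unfolding d_def split by (rule sum.union_disjoint) auto
    also have "(\<Sum>n\<in>{1..N k}. prob (F (Suc k) n)) = 0"
      by (intro sum.neutral) (simp add: old)
    also have "(\<Sum>n\<in>{N k<..N (Suc k)}. prob (F (Suc k) n)) \<le> D * (s k + d k)"
      by (rule step[OF new D])
    finally show ?thesis by simp
  qed
  have "s 0 \<le> (\<Sum>n\<in>{1..N 0}. 1)" unfolding s_def by (intro sum_mono) auto
  hence "L * s 0 + (L - 1) * d 0 \<le> L * real (N 0)"
    using L(1) by (simp add: d_def F_def mult_left_mono)
  hence init: "(L * s 0 + (L - 1) * d 0) / (L - 1) * L ^ k \<le> L * real (N 0) / (L - 1) * L ^ k"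
    using L(1) by (intro mult_right_mono divide_right_mono) auto
  have "(\<Sum>n\<in>{1..N k}. prob {x \<in> space M. n \<in> core (\<lambda>i. \<omega> i x) N R k \<union> fringe (\<lambda>i. \<omega> i x) N R k})
      = (\<Sum>n\<in>{1..N k}. prob (C k n \<union> F k n))"
    by (intro sum.cong arg_cong[of _ _ prob]) (auto simp: C_def F_def)
  also have "\<dots> \<le> s k + d k"
    unfolding s_def d_def sum.distrib[symmetric] by (intro sum_mono CF)
  also have "\<dots> \<le> (L * s 0 + (L - 1) * d 0) / (L - 1) * L ^ k"
    by (rule two_type_growth[of s d T D L k, OF nn s_Suc d_Suc L])
  finally show ?thesis using init by linarith
qed

text \<open>
  The expectation of the sum over all \<open>k\<close> is finite, so almost surely the sum converges and its terms
  tend to \<open>0\<close>.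
\<close>
lemma (in prob_space) AE_card_tendsto_0:
  fixes A :: "nat \<Rightarrow> 'a \<Rightarrow> nat set"
  assumes A: "\<And>k x. A k x \<subseteq> {1..N k}" and meas: "\<And>k n. {x \<in> space M. n \<in> A k x} \<in> events"
    and bound: "\<And>k. (\<Sum>n\<in>{1..N k}. prob {x \<in> space M. n \<in> A k x}) \<le> C * L ^ k"
    and C: "0 \<le> C" and L: "0 \<le> L" and q: "0 < q" "L * q < 1"
  shows "AE x in M. (\<lambda>k. real (card (A k x)) * q ^ k) \<longlonglongrightarrow> 0"
proof -
  define f where "f = (\<lambda>k x. \<Sum>n\<in>{1..N k}. indicator {x \<in> space M. n \<in> A k x} x * ennreal (q ^ k))"
  have f: "f k x = ennreal (real (card (A k x)) * q ^ k)" if "x \<in> space M" for k x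
  proof -
    have "f k x = (\<Sum>n\<in>{1..N k}. if n \<in> A k x then ennreal (q ^ k) else 0)"
      unfolding f_def using that by (intro sum.cong) auto
    also have "\<dots> = (\<Sum>n\<in>A k x. ennreal (q ^ k))"
      using A[of k x] by (subst sum.inter_restrict[symmetric]) (auto simp: Int_absorb1)
    also have "\<dots> = ennreal (real (card (A k x)) * q ^ k)"
      using q by (simp add: ennreal_mult ennreal_of_nat_eq_real_of_nat)
    finally show ?thesis .
  qed
  have [measurable]: "f k \<in> borel_measurable M" for k
    unfolding f_def using meas by (intro borel_measurable_sum borel_measurable_times_ennreal borel_measurable_indicator) auto
  have int: "(\<integral>\<^sup>+x. f k x \<partial>M) \<le> ennreal (C * (L * q) ^ k)" for k
  proof -
    have "(\<integral>\<^sup>+x. f k x \<partial>M) = (\<Sum>n\<in>{1..N k}. emeasure M {x \<in> space M. n \<in> A k x} * ennreal (q ^ k))"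
      unfolding f_def using meas
      by (subst nn_integral_sum) (auto simp: nn_integral_multc intro!: sum.cong)
    also have "\<dots> = ennreal ((\<Sum>n\<in>{1..N k}. prob {x \<in> space M. n \<in> A k x}) * q ^ k)"
      using q by (simp add: emeasure_eq_measure ennreal_mult[symmetric] sum_distrib_right)
    also have "\<dots> \<le> ennreal (C * L ^ k * q ^ k)"
      using bound[of k] q by (intro ennreal_leI mult_right_mono) auto
    finally show ?thesis by (simp add: power_mult_distrib mult.assoc)
  qed
  have "(\<integral>\<^sup>+x. (\<Sum>k. f k x) \<partial>M) = (\<Sum>k. \<integral>\<^sup>+x. f k x \<partial>M)"
    by (rule nn_integral_suminf) simp
  also have "\<dots> \<le> (\<Sum>k. ennreal (C * (L * q) ^ k))"
    using int by (intro suminf_le) auto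
  also have "\<dots> < \<infinity>"
    using L q C by (simp add: less_top[symmetric] summable_geometric ennreal_suminf_neq_top)
  finally have "AE x in M. (\<Sum>k. f k x) \<noteq> \<infinity>"
    by (intro nn_integral_PInf_AE) auto
  thus ?thesis
  proof (rule AE_mp, intro AE_I2 impI)
    fix x assume x: "x \<in> space M" "(\<Sum>k. f k x) \<noteq> \<infinity>"
    hence "(\<Sum>k. ennreal (real (card (A k x)) * q ^ k)) \<noteq> top" by (simp add: f)
    hence "summable (\<lambda>k. real (card (A k x)) * q ^ k)"
      using q by (intro summable_suminf_not_top) auto
    thus "(\<lambda>k. real (card (A k x)) * q ^ k) \<longlonglongrightarrow> 0" by (rule summable_LIMSEQ_zero)
  qed
qed

section \<open>The growth rate\<close>

lemma Theta_pos: "0 < c \<Longrightarrow> 1 < \<theta> \<Longrightarrow> 0 < Theta c \<theta>"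
  unfolding Theta_def by (intro mult_pos_pos add_pos_nonneg) auto

text \<open>
  \<open>Lambda\<close> is the larger zero of \<open>x\<^sup>2 - (1 + Theta + Delta) * x + Delta\<close>, a polynomial which takes the
  negative value \<open>- Theta\<close> at \<open>1\<close>.
\<close>
lemma Lambda_gt_1_and_root:
  assumes "0 < c" "1 < \<theta>"
  shows Lambda_gt_1: "1 < Lambda c \<theta>"
    and Lambda_root: "Lambda c \<theta> * (1 + Theta c \<theta>) + (Lambda c \<theta> - 1) * Delta c \<theta> = (Lambda c \<theta>)\<^sup>2"
proof -
  define b where "b = (1 + Theta c \<theta> + Delta c \<theta>) / 2"
  have L: "Lambda c \<theta> = b + sqrt (b\<^sup>2 - Delta c \<theta>)" by (simp add: Lambda_def b_def)
  have disc: "(1 - b)\<^sup>2 < b\<^sup>2 - Delta c \<theta>"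
    using Theta_pos[OF assms] by (simp add: power2_eq_square algebra_simps b_def)
  from real_less_rsqrt[OF this] show "1 < Lambda c \<theta>" by (simp add: L)
  have "0 \<le> b\<^sup>2 - Delta c \<theta>" using disc zero_le_power2[of "1 - b"] by linarith
  hence "(sqrt (b\<^sup>2 - Delta c \<theta>))\<^sup>2 = b\<^sup>2 - Delta c \<theta>" by simp
  hence "(Lambda c \<theta> - b)\<^sup>2 = b\<^sup>2 - Delta c \<theta>" by (simp add: L)
  hence "(Lambda c \<theta>)\<^sup>2 = 2 * b * Lambda c \<theta> - Delta c \<theta>"
    by (simp add: power2_eq_square algebra_simps)
  also have "\<dots> = Lambda c \<theta> * (1 + Theta c \<theta>) + (Lambda c \<theta> - 1) * Delta c \<theta>"
    by (simp add: b_def algebra_simps)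
  finally show "Lambda c \<theta> * (1 + Theta c \<theta>) + (Lambda c \<theta> - 1) * Delta c \<theta> = (Lambda c \<theta>)\<^sup>2" ..
qed

lemma isCont_Lambda: "isCont (\<lambda>c. Lambda c \<theta>) c"
  unfolding Lambda_def Theta_def Delta_def by (intro continuous_intros) auto

section \<open>The dimension bound\<close>

text \<open>
  The counting argument is run separately from every large starting generation \<open>K\<close>, all of whose
  indices are relevant initially, and bounds the set \<open>G K\<close> of the points covered in each
  generation from \<open>K\<close> on. These sets exhaust the uniformly covered set.
\<close>
lemma (in prob_space) AE_hausdorff_measure_uniform_cover_set_eq_0:
  fixes \<omega> :: "nat \<Rightarrow> 'a \<Rightarrow> torus"
  assumes indep: "indep_vars (\<lambda>_. borel) \<omega> {1..}"
    and unif: "\<And>n. n \<ge> 1 \<Longrightarrow> distr M borel (\<omega> n) = torus_uniform"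
    and c: "0 < c" and \<theta>: "1 < \<theta>" and s: "ln (Lambda c \<theta>) / ln \<theta> < s"
  shows "AE x in M. hausdorff_measure s (uniform_cover_set (\<lambda>n. \<omega> n x) (\<lambda>n. c / real n)) = 0"
proof -
  have "0 < ln (Lambda c \<theta>) / ln \<theta>" using Lambda_gt_1[OF c \<theta>] \<theta> by simp
  hence s0: "0 < s" using s by simp
  have "ln (Lambda c \<theta>) < s * ln \<theta>" using s \<theta> by (simp add: field_simps)
  hence "exp (ln (Lambda c \<theta>)) < exp (s * ln \<theta>)" by simp
  hence "Lambda c \<theta> < \<theta> powr s" using Lambda_gt_1[OF c \<theta>] \<theta> by (simp add: powr_def)
  hence "eventually (\<lambda>b. Lambda b \<theta> < \<theta> powr s) (at c)"
    using isCont_Lambda[where c = c and \<theta> = \<theta>] by (intro order_tendstoD(2)) (auto simp: isCont_def)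
  hence "eventually (\<lambda>b. Lambda b \<theta> < \<theta> powr s) (at_right c)" by (simp add: eventually_at_split)
  hence "eventually (\<lambda>b. Lambda b \<theta> < \<theta> powr s \<and> b > c) (at_right c)"
    by (intro eventually_conj) (auto simp: eventually_at_right_less)
  then obtain b where b: "Lambda b \<theta> < \<theta> powr s" "c < b"
    using eventually_happens'[OF trivial_limit_at_right_real] by blast
  \<comment> \<open>The constant \<open>b\<close> takes the place of \<open>c\<close> in \<open>Theta\<close> and \<open>Delta\<close>, to absorb the rounding in \<open>N\<close>.\<close>
  define L where "L = Lambda b \<theta>"
  have L1: "1 < L" using Lambda_gt_1[of b \<theta>] b c \<theta> by (simp add: L_def)
  define N where "N = (\<lambda>k. nat \<lceil>\<theta> ^ k\<rceil>)"
  define R where "R = (\<lambda>k. c / \<theta> ^ k)"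
  have pow_pos: "0 < \<theta> ^ k" for k using \<theta> by simp
  have N_ge: "\<theta> ^ k \<le> real (N k)" and N_lt: "real (N k) < \<theta> ^ k + 1" for k
    unfolding N_def using pow_pos[of k] by linarith+
  have N_mono: "mono N"
    unfolding N_def using \<theta> by (intro monoI nat_mono ceiling_mono power_increasing) auto
  obtain K0 where K0: "c / ((b - c) * (\<theta> - 1)) < \<theta> ^ K0" using real_arch_pow[OF \<theta>] by blast
  \<comment> \<open>From generation \<open>K0\<close> on, the excess \<open>(b - c) * (\<theta> - 1) * \<theta> ^ j\<close> exceeds the rounding error,
    which is at most \<open>c\<close>.\<close>
  have inc: "(real (N (Suc j)) - real (N j)) * (c / \<theta> ^ j) \<le> b * (\<theta> - 1)" if j: "j \<ge> K0" for j
  proof -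
    have "c / ((b - c) * (\<theta> - 1)) < \<theta> ^ j"
      using K0 power_increasing[OF j less_imp_le[OF \<theta>]] by (rule less_le_trans)
    hence "c < (b - c) * (\<theta> - 1) * \<theta> ^ j"
      using b \<theta> by (subst (asm) pos_divide_less_eq) (simp_all add: mult.commute)
    moreover have "real (N (Suc j)) - real (N j) \<le> \<theta> ^ j * (\<theta> - 1) + 1"
      using N_lt[of "Suc j"] N_ge[of j] by (simp add: algebra_simps)
    hence "(real (N (Suc j)) - real (N j)) * c \<le> (\<theta> ^ j * (\<theta> - 1) + 1) * c"
      using c by (intro mult_right_mono) auto
    ultimately have "(real (N (Suc j)) - real (N j)) * c \<le> b * (\<theta> - 1) * \<theta> ^ j"
      by (simp add: algebra_simps)
    thus ?thesis using pow_pos[of j] by (simp add: pos_divide_le_eq)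
  qed
  have R_Suc: "R (j + 2) = c / \<theta> ^ j * (1 / \<theta>\<^sup>2)" "R (j + 1) = c / \<theta> ^ j * (1 / \<theta>)" for j
    by (auto simp: R_def power_add power2_eq_square)
  have factor: "a * (2 * (p + p * z)) = a * p * (2 * (1 + z))"
    "a * (2 * (p * u - p * z)) = a * p * (2 * (u - z))" for a p u z :: real
    by (simp_all add: algebra_simps)
  define G where "G = (\<lambda>K x. {y. \<forall>k. y \<in> (\<Union>n\<in>{1..N (K + k)}. ball (\<omega> n x) (R (K + k)))})"
  have null: "AE x in M. hausdorff_measure s (G K x) = 0" if K: "K \<ge> K0" for K
  proof -
    define N' R' where "N' = (\<lambda>k. N (K + k))" and "R' = (\<lambda>k. R (K + k))"
    define A where "A = (\<lambda>k x. core (\<lambda>i. \<omega> i x) N' R' k \<union> fringe (\<lambda>i. \<omega> i x) N' R' k)"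
    have N': "mono N'" unfolding N'_def using N_mono by (auto simp: mono_def)
    have R'_pos: "0 < R' k" for k using c pow_pos by (simp add: R'_def R_def)
    have R': "decseq R'"
      unfolding R'_def R_def using c \<theta> by (intro decseq_SucI divide_left_mono) auto
    have A_sub: "A k x \<subseteq> {1..N' k}" for k x
      unfolding A_def using core_subset_fringe_subset[OF N'] by (intro Un_least)
    have A_meas: "{x \<in> space M. n \<in> A k x} \<in> events" for k n
    proof -
      have "{x \<in> space M. n \<in> A k x} = {x \<in> space M. n \<in> core (\<lambda>i. \<omega> i x) N' R' k} \<union> {x \<in> space M. n \<in> fringe (\<lambda>i. \<omega> i x) N' R' k}"
        by (auto simp: A_def)
      thus ?thesis using core_fringe_events[OF indep N'] by (auto intro: sets.Un)
    qed
    have bound: "(\<Sum>n\<in>{1..N' k}. prob {x \<in> space M. n \<in> A k x}) \<le> L * real (N' 0) / (L - 1) * L ^ k" for k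
      unfolding A_def
    proof (rule expected_core_fringe_le[OF indep unif N' R' less_imp_le[OF R'_pos] _ _ L1])
      fix k
      have inc': "(real (N' (Suc k)) - real (N' k)) * (c / \<theta> ^ (K + k)) \<le> b * (\<theta> - 1)"
        using inc[of "K + k"] K by (simp add: N'_def)
      have R'_eq: "R' k = c / \<theta> ^ (K + k)" "R' (k + 2) = c / \<theta> ^ (K + k) * (1 / \<theta>\<^sup>2)"
        "R' (k + 1) = c / \<theta> ^ (K + k) * (1 / \<theta>)"
        using R_Suc[of "K + k"] by (simp_all only: R'_def add.assoc) (simp only: R_def)
      have "(real (N' (Suc k)) - real (N' k)) * (2 * (R' k + R' (k + 2)))
          = (real (N' (Suc k)) - real (N' k)) * (c / \<theta> ^ (K + k)) * (2 * (1 + 1 / \<theta>\<^sup>2))"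
        unfolding R'_eq by (rule factor)
      also have "\<dots> \<le> b * (\<theta> - 1) * (2 * (1 + 1 / \<theta>\<^sup>2))"
        using inc' by (rule mult_right_mono) auto
      also have "\<dots> = Theta b \<theta>" by (simp add: Theta_def)
      finally show "(real (N' (Suc k)) - real (N' k)) * (2 * (R' k + R' (k + 2))) \<le> Theta b \<theta>" .
      have "\<theta> \<le> \<theta>\<^sup>2" using \<theta> by (simp add: power2_eq_square)
      hence d: "0 \<le> 1 / \<theta> - 1 / \<theta>\<^sup>2" using \<theta> by (simp add: frac_le)
      have "(real (N' (Suc k)) - real (N' k)) * (2 * (R' (k + 1) - R' (k + 2)))
          = (real (N' (Suc k)) - real (N' k)) * (c / \<theta> ^ (K + k)) * (2 * (1 / \<theta> - 1 / \<theta>\<^sup>2))"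
        unfolding R'_eq by (rule factor)
      also have "\<dots> \<le> b * (\<theta> - 1) * (2 * (1 / \<theta> - 1 / \<theta>\<^sup>2))"
        using inc' d by (intro mult_right_mono) auto
      also have "\<dots> = Delta b \<theta>" by (simp add: Delta_def)
      finally show "(real (N' (Suc k)) - real (N' k)) * (2 * (R' (k + 1) - R' (k + 2))) \<le> Delta b \<theta>" .
    next
      show "L * (1 + Theta b \<theta>) + (L - 1) * Delta b \<theta> \<le> L\<^sup>2"
        using Lambda_root[of b \<theta>] b c \<theta> by (simp add: L_def)
    qed
    define q where "q = \<theta> powr (- s)"
    have q: "0 < q" "L * q < 1" using b(1) \<theta> by (auto simp: q_def L_def powr_minus field_simps)
    have "AE x in M. (\<lambda>k. real (card (A k x)) * q ^ k) \<longlonglongrightarrow> 0"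
      using L1 q by (intro AE_card_tendsto_0[OF A_sub A_meas bound]) auto
    thus ?thesis
    proof (rule AE_mp, intro AE_I2 impI)
      fix x assume lim: "(\<lambda>k. real (card (A k x)) * q ^ k) \<longlonglongrightarrow> 0"
      show "hausdorff_measure s (G K x) = 0"
      proof (rule hausdorff_measure_eq_0_if_covers[OF s0, where F = "\<lambda>k. A k x" and R = R' and z = "\<lambda>n. \<omega> n x"])
        show "finite (A k x)" for k using A_sub by (rule finite_subset) simp
        show "0 < R' k" for k by (rule R'_pos)
        have "(\<lambda>k. c / \<theta> ^ K * (1 / \<theta>) ^ k) \<longlonglongrightarrow> c / \<theta> ^ K * 0"
          using \<theta> by (intro tendsto_mult_left LIMSEQ_realpow_zero) auto
        thus "R' \<longlonglongrightarrow> 0" by (simp add: R'_def R_def power_add power_divide)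
        show "G K x \<subseteq> (\<Union>n\<in>A k x. ball (\<omega> n x) (R' k))" for k
        proof
          fix y assume "y \<in> G K x"
          hence y: "y \<in> (\<Union>n\<in>{1..N' j}. ball (\<omega> n x) (R' j))" for j by (simp add: G_def N'_def R'_def)
          then obtain n where n: "n \<in> {1..N' k}" "dist (\<omega> n x) y < R' k" by fastforce
          have "n \<in> A k x" unfolding A_def
            by (rule covering_index_in_core_fringe[where y = y]) (use R' y n in auto)
          thus "y \<in> (\<Union>n\<in>A k x. ball (\<omega> n x) (R' k))" using n by auto
        qed
        have "R' k powr s = (c / \<theta> ^ K) powr s * q ^ k" for k
        proof -
          have "R' k powr s = (c / \<theta> ^ K * (1 / \<theta> ^ k)) powr s" by (simp add: R'_def R_def power_add)
          also have "\<dots> = (c / \<theta> ^ K) powr s * (1 / \<theta> ^ k) powr s"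
            by (rule powr_mult)
          also have "(1 / \<theta> ^ k) powr s = q ^ k"
            using \<theta> by (simp add: q_def powr_realpow[symmetric] powr_powr powr_divide powr_minus field_simps)
          finally show ?thesis .
        qed
        thus "(\<lambda>k. real (card (A k x)) * R' k powr s) \<longlonglongrightarrow> 0"
          using tendsto_mult_left[OF lim, of "(c / \<theta> ^ K) powr s"] by (simp add: mult_ac)
      qed
    qed
  qed
  have "AE x in M. \<forall>j. hausdorff_measure s (G (K0 + j) x) = 0"
    using null by (subst AE_all_countable) auto
  thus ?thesis
  proof (rule AE_mp, intro AE_I2 impI)
    fix x assume "\<forall>j. hausdorff_measure s (G (K0 + j) x) = 0"
    hence "hausdorff_measure s (\<Union>j. G (K0 + j) x) = 0"
      by (intro hausdorff_measure_UN_eq_0) auto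
    moreover have "uniform_cover_set (\<lambda>n. \<omega> n x) (\<lambda>n. c / real n) \<subseteq> (\<Union>j. G (K0 + j) x)"
    proof
      fix y assume "y \<in> uniform_cover_set (\<lambda>n. \<omega> n x) (\<lambda>n. c / real n)"
      then obtain N0 where N0: "\<And>n. n \<ge> N0 \<Longrightarrow> \<exists>i\<in>{1..n}. dist (\<omega> i x) y < c / real n"
        unfolding uniform_cover_set_def by auto
      obtain j where j: "real N0 < \<theta> ^ j" using real_arch_pow[OF \<theta>] by blast
      have "y \<in> (\<Union>n\<in>{1..N (K0 + j + k)}. ball (\<omega> n x) (R (K0 + j + k)))" for k
      proof -
        let ?k = "K0 + j + k"
        have "real N0 < \<theta> ^ ?k" using j power_increasing[of j ?k \<theta>] \<theta> by linarith
        hence "N0 \<le> N ?k" using N_ge[of ?k] by linarith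
        then obtain i where i: "i \<in> {1..N ?k}" "dist (\<omega> i x) y < c / real (N ?k)" using N0 by blast
        have "c / real (N ?k) \<le> R ?k"
          unfolding R_def using N_ge[of ?k] pow_pos[of ?k] c
          by (intro divide_left_mono mult_pos_pos) auto
        thus ?thesis using i by (intro UN_I[of i]) auto
      qed
      thus "y \<in> (\<Union>j. G (K0 + j) x)" by (auto simp: G_def)
    qed
    ultimately show "hausdorff_measure s (uniform_cover_set (\<lambda>n. \<omega> n x) (\<lambda>n. c / real n)) = 0"
      by (metis hausdorff_measure_mono le_zero_eq)
  qed
qed

text \<open>
  The infimum ranges over uncountably many \<open>\<theta>\<close>, each with its own exceptional null set. It is enough
  to treat the countably many rational exponents above the infimum, each with one suitable \<open>\<theta>\<close>.
\<close>
lemma (in prob_space) AE_hausdorff_dim_le_dim_bound: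
  fixes \<omega> :: "nat \<Rightarrow> 'a \<Rightarrow> torus"
  assumes indep: "indep_vars (\<lambda>_. borel) \<omega> {1..}"
    and unif: "\<And>n. n \<ge> 1 \<Longrightarrow> distr M borel (\<omega> n) = torus_uniform" and c: "0 < c"
  shows "AE x in M. hausdorff_dim (uniform_cover_set (\<lambda>n. \<omega> n x) (\<lambda>n. c / real n)) \<le> dim_bound c"
proof -
  let ?U = "\<lambda>x. uniform_cover_set (\<lambda>n. \<omega> n x) (\<lambda>n. c / real n)"
  have rat: "AE x in M. \<forall>r::rat. dim_bound c < ereal (of_rat r) \<longrightarrow> hausdorff_dim (?U x) \<le> ereal (of_rat r)"
  proof (subst AE_all_countable, intro allI)
    fix r :: rat
    show "AE x in M. dim_bound c < ereal (of_rat r) \<longrightarrow> hausdorff_dim (?U x) \<le> ereal (of_rat r)"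
    proof (cases "dim_bound c < ereal (of_rat r)")
      case True
      then obtain \<theta> where \<theta>: "1 < \<theta>" "ln (Lambda c \<theta>) / ln \<theta> < of_rat r"
        by (auto simp: dim_bound_def INF_less_iff)
      have "0 < ln (Lambda c \<theta>) / ln \<theta>" using Lambda_gt_1[OF c \<theta>(1)] \<theta> by simp
      hence "0 \<le> real_of_rat r" using \<theta> by linarith
      from AE_hausdorff_measure_uniform_cover_set_eq_0[OF indep unif c \<theta>]
      show ?thesis by (rule AE_mp) (use \<open>0 \<le> real_of_rat r\<close> in \<open>auto intro!: AE_I2 hausdorff_dim_le\<close>)
    qed auto
  qed
  show ?thesis
  proof (rule AE_mp[OF rat], intro AE_I2 impI)
    fix x assume x: "\<forall>r::rat. dim_bound c < ereal (of_rat r) \<longrightarrow> hausdorff_dim (?U x) \<le> ereal (of_rat r)"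
    show "hausdorff_dim (?U x) \<le> dim_bound c"
    proof (rule dense_ge)
      fix z assume "dim_bound c < z"
      then obtain t where t: "dim_bound c < ereal t" "ereal t < z" using ereal_dense2 by blast
      then obtain t' where t': "ereal t < ereal t'" "ereal t' < z" using ereal_dense2 by blast
      then obtain r where r: "t < of_rat r" "of_rat r < t'" using of_rat_dense[of t t'] by auto
      have "dim_bound c < ereal (of_rat r)" using t(1) r(1) by (metis less_ereal.simps(1) order.strict_trans)
      hence "hausdorff_dim (?U x) \<le> ereal (of_rat r)" using x by blast
      also have "\<dots> \<le> z" using r(2) t'(2) by (metis less_ereal.simps(1) order.strict_trans less_imp_le)
      finally show "hausdorff_dim (?U x) \<le> z" .
    qed
  qed
qed

lemma dim_bound_nonneg:
  assumes "0 < c" shows "0 \<le> dim_bound c"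
  unfolding dim_bound_def
proof (rule INF_greatest)
  fix \<theta> :: real assume "\<theta> \<in> {1<..}"
  thus "0 \<le> ereal (ln (Lambda c \<theta>) / ln \<theta>)" using Lambda_gt_1[OF assms, of \<theta>] by simp
qed

text \<open>
  The single value \<open>\<theta> = 2\<close> suffices: \<open>Lambda c 2\<close> is continuous in \<open>c\<close> and equals \<open>1\<close> at \<open>c = 0\<close>.
\<close>
lemma tendsto_dim_bound_0: "(dim_bound \<longlongrightarrow> 0) (at_right 0)"
proof (rule tendsto_sandwich)
  show "eventually (\<lambda>c. 0 \<le> dim_bound c) (at_right 0)"
    using eventually_at_right_less[of 0] by eventually_elim (rule dim_bound_nonneg)
  show "eventually (\<lambda>c. dim_bound c \<le> ereal (ln (Lambda c 2) / ln 2)) (at_right 0)"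
    by (intro always_eventually allI) (auto simp: dim_bound_def intro: INF_lower)
  show "((\<lambda>c. 0 :: ereal) \<longlongrightarrow> 0) (at_right 0)" by simp
  have L0: "Lambda 0 2 = 1" by (simp add: Lambda_def Theta_def Delta_def)
  have "((\<lambda>c. Lambda c 2) \<longlongrightarrow> Lambda 0 2) (at_right 0)"
    using isCont_Lambda[where c = 0 and \<theta> = 2] by (simp add: isCont_def filterlim_at_split)
  hence "((\<lambda>c. ln (Lambda c 2) / ln 2) \<longlongrightarrow> ln (Lambda 0 2) / ln 2) (at_right 0)"
    by (intro tendsto_intros) (auto simp: L0)
  thus "((\<lambda>c. ereal (ln (Lambda c 2) / ln 2)) \<longlongrightarrow> 0) (at_right 0)"
    by (simp add: L0 zero_ereal_def)
qed

lemma uniform_cover_set_eventually_mono: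
  assumes "eventually (\<lambda>n. r n \<le> r' n) sequentially"
  shows "uniform_cover_set w r \<subseteq> uniform_cover_set w r'"
proof
  fix y assume "y \<in> uniform_cover_set w r"
  then obtain N0 where N0: "\<And>N. N \<ge> N0 \<Longrightarrow> \<exists>n\<in>{1..N}. dist (w n) y < r N"
    by (auto simp: uniform_cover_set_def)
  obtain N1 where "\<And>N. N \<ge> N1 \<Longrightarrow> r N \<le> r' N" using assms by (auto simp: eventually_sequentially)
  with N0 have "\<forall>N\<ge>max N0 N1. \<exists>n\<in>{1..N}. dist (w n) y < r' N" by (meson less_le_trans max.bounded_iff)
  thus "y \<in> uniform_cover_set w r'" unfolding uniform_cover_set_def by blast
qed

lemma powr_radius_eventually_le:
  assumes "1 < (\<alpha>::real)" "0 < c"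
  shows "eventually (\<lambda>n. 1 / real n powr \<alpha> \<le> c / real n) sequentially"
proof -
  have "((\<lambda>n. real n powr (1 - \<alpha>)) \<longlongrightarrow> 0) sequentially"
    using assms by (intro tendsto_neg_powr filterlim_real_sequentially) auto
  hence "eventually (\<lambda>n. real n powr (1 - \<alpha>) < c) sequentially"
    using assms by (intro order_tendstoD(2)) auto
  thus ?thesis using eventually_gt_at_top[of 0]
  proof eventually_elim
    case (elim n)
    hence "1 / real n powr \<alpha> = real n powr (1 - \<alpha>) / real n" by (simp add: powr_diff)
    also have "\<dots> \<le> c / real n" using elim by (intro divide_right_mono) auto
    finally show ?case .
  qed
qed

theorem theorem4:
  fixes M :: "'a measure" and \<omega> :: "nat \<Rightarrow> 'a \<Rightarrow> torus"
  assumes "prob_space M"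
    and "prob_space.indep_vars M (\<lambda>_. borel) \<omega> {1..}"
    and "\<And>n. n \<ge> 1 \<Longrightarrow> distr M borel (\<omega> n) = torus_uniform"
  shows "(\<forall>c::real. 0 < c \<and> c < 1 / 2 \<longrightarrow>
           (AE x in M. hausdorff_dim (uniform_cover_set (\<lambda>n. \<omega> n x) (\<lambda>n. c / real n)) \<le> dim_bound c))
       \<and> (dim_bound \<longlongrightarrow> 0) (at_right 0)
       \<and> (\<forall>\<alpha>::real. \<alpha> > 1 \<longrightarrow>
           (AE x in M. hausdorff_dim (uniform_cover_set (\<lambda>n. \<omega> n x) (\<lambda>n. 1 / real n powr \<alpha>)) = 0))"
proof -
  interpret prob_space M by fact
  note bound = AE_hausdorff_dim_le_dim_bound[OF assms(2,3)]
  have "AE x in M. hausdorff_dim (uniform_cover_set (\<lambda>n. \<omega> n x) (\<lambda>n. 1 / real n powr \<alpha>)) = 0"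
    if \<alpha>: "\<alpha> > 1" for \<alpha> :: real
  proof -
    define c where "c = (\<lambda>j. 1 / real (Suc j))"
    have c: "0 < c j" for j by (simp add: c_def)
    have "AE x in M. \<forall>j. hausdorff_dim (uniform_cover_set (\<lambda>n. \<omega> n x) (\<lambda>n. c j / real n)) \<le> dim_bound (c j)"
      using bound[OF _ c] by (subst AE_all_countable) auto
    thus ?thesis
    proof (rule AE_mp, intro AE_I2 impI)
      fix x assume x: "\<forall>j. hausdorff_dim (uniform_cover_set (\<lambda>n. \<omega> n x) (\<lambda>n. c j / real n)) \<le> dim_bound (c j)"
      let ?d = "hausdorff_dim (uniform_cover_set (\<lambda>n. \<omega> n x) (\<lambda>n. 1 / real n powr \<alpha>))"
      have "?d \<le> dim_bound (c j)" for j
        using hausdorff_dim_mono[OF uniform_cover_set_eventually_mono[OF powr_radius_eventually_le[OF \<alpha> c]]] x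
        by (blast intro: order_trans)
      moreover have "filterlim c (at_right 0) sequentially"
        unfolding filterlim_at using LIMSEQ_inverse_real_of_nat by (simp add: c_def inverse_eq_divide)
      hence "(\<lambda>j. dim_bound (c j)) \<longlonglongrightarrow> 0"
        by (rule filterlim_compose[OF tendsto_dim_bound_0])
      ultimately have "?d \<le> 0" by (intro LIMSEQ_le_const) auto
      thus "?d = 0" using hausdorff_dim_nonneg by (rule antisym)
    qed
  qed
  thus ?thesis using bound tendsto_dim_bound_0 by blast
qed

end
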